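(* Let $\Phi$ be a metric space with a bornology $\mathbb{B}$, let $\mathcal{C}\subset\mathbb{R}^m$ be a closed cone with non-empty interior, let $\Sigma\subset\mathcal{C}$ be a time arrow, and let $S(h):\Phi\to\Phi$, $h\in\mathcal{C}$, be a multi-parametric semigroup. Assume that: 1. the operators $S(h):\Phi\to\Phi$ are continuous for all $h\in\mathcal{C}$; 2. the semigroup $S(h)$ possesses a compact $(\mathbb{B},\Sigma)$-attracting set $K\subset\Phi$. Then there exists a $(\mathbb{B},\Sigma)$-attractor $\mathcal{A}\subset K$ of this semigroup.
   Context: Setting and definitions. - $\mathcal{C}\subset\mathbb{R}^m$ is a closed cone with non-empty interior, closed under addition ($\mathcal{C}+\mathcal{C}\subset\mathcal{C}$) and containing $0$; the case $\mathcal{C}=\mathbb{R}^m$ is allowed. - A multi-parametric semigroup is a family of maps $S(h):\Phi\to\Phi$, $h\in\mathcal{C}$, with $S(0)=\mathrm{Id}$ and $S(h_1+h_2)=S(h_1)\circ S(h_2)$ for all $h_1,h_2\in\mathcal{C}$. - A bornology $\mathbb{B}$ on $\Phi$ means here an arbitrary collection of subsets of $\Phi$; its members are called "bounded" sets. - A time arrow is a non-empty set $\Sigma\subset\mathcal{C}$ such that $\partial\mathcal{C}\subset\partial\Sigma$ (boundaries in $\mathbb{R}^m$) and such that for every $D>0$ there is a point $h_D\in\Sigma$ with $d(h_D,\partial\Sigma)\ge D$. Here $d(h,V)$ is the Euclidean distance from the point $h$ to the set $V$ in $\mathbb{R}^m$, with $d(h,\emptyset)=+\infty$. - A set $K\subset\Phi$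 is $(\mathbb{B},\Sigma)$-attracting if for every $B\in\mathbb{B}$ and every neighbourhood $\mathcal{O}(K)$ of $K$ in $\Phi$ there is $D=D(B,\mathcal{O})$ such that $S(h)B\subset\mathcal{O}(K)$ for all $h\in\Sigma$ with $d(h,\partial\Sigma)\ge D$. - A set $\mathcal{A}\subset\Phi$ is a $(\mathbb{B},\Sigma)$-attractor of $S(h)$ if (1) $\mathcal{A}$ is compact in $\Phi$; (2) $\mathcal{A}$ is strictly invariant: $S(h)\mathcal{A}=\mathcal{A}$ for all $h\in\mathcal{C}$; (3) $\mathcal{A}$ is $(\mathbb{B},\Sigma)$-attracting. *)

theory Defs
  imports "HOL-Analysis.Analysis" "HOL-Library.Extended_Real"
begin

text \<open>
  The distance from a point to a set is taken in the extended reals, so that the distance to the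
  empty set is \<open>\<infinity>\<close> (in contrast to \<open>infdist\<close>, which is \<open>0\<close> there).
\<close>

definition set_distance :: "'a::metric_space \<Rightarrow> 'a set \<Rightarrow> ereal" where
  "set_distance h V = (INF v\<in>V. ereal (dist h v))"

lemma set_distance_empty: "set_distance h {} = \<infinity>"
  by (simp add: set_distance_def top_ereal_def)

definition time_cone :: "(real ^ 'm) set \<Rightarrow> bool" where
  "time_cone C \<longleftrightarrow>
     cone C \<and> closed C \<and> interior C \<noteq> {} \<and> 0 \<in> C \<and> (\<forall>x\<in>C. \<forall>y\<in>C. x + y \<in> C)"

definition multi_semigroup :: "(real ^ 'm) set \<Rightarrow> (real ^ 'm \<Rightarrow> 'a \<Rightarrow> 'a) \<Rightarrow> bool" where
  "multi_semigroup C S \<longleftrightarrow>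
     S 0 = id \<and> (\<forall>h1\<in>C. \<forall>h2\<in>C. S (h1 + h2) = S h1 \<circ> S h2)"

definition time_arrow :: "(real ^ 'm) set \<Rightarrow> (real ^ 'm) set \<Rightarrow> bool" where
  "time_arrow C \<Sigma> \<longleftrightarrow>
     \<Sigma> \<noteq> {} \<and> \<Sigma> \<subseteq> C \<and> frontier C \<subseteq> frontier \<Sigma> \<and>
     (\<forall>D>0. \<exists>h\<in>\<Sigma>. set_distance h (frontier \<Sigma>) \<ge> ereal D)"

text \<open>
  A bornology is an arbitrary collection of subsets of the phase space; no closure properties
  are imposed.  A neighbourhood of a set \<open>K\<close> is a set whose interior contains \<open>K\<close>.
\<close>

definition attracting ::
    "'a::metric_space set set \<Rightarrow> (real ^ 'm) set \<Rightarrow> (real ^ 'm \<Rightarrow> 'a \<Rightarrow> 'a) \<Rightarrow> 'a set \<Rightarrow> bool" where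
  "attracting \<B> \<Sigma> S K \<longleftrightarrow>
     (\<forall>B\<in>\<B>. \<forall>U. K \<subseteq> interior U \<longrightarrow>
        (\<exists>D>0. \<forall>h\<in>\<Sigma>. set_distance h (frontier \<Sigma>) \<ge> ereal D \<longrightarrow> S h ` B \<subseteq> U))"

definition attractor ::
    "'a::metric_space set set \<Rightarrow> (real ^ 'm) set \<Rightarrow> (real ^ 'm) set \<Rightarrow>
       (real ^ 'm \<Rightarrow> 'a \<Rightarrow> 'a) \<Rightarrow> 'a set \<Rightarrow> bool" where
  "attractor \<B> C \<Sigma> S A \<longleftrightarrow>
     compact A \<and> (\<forall>h\<in>C. S h ` A = A) \<and> attracting \<B> \<Sigma> S A"

end

theory Submission imports Defs begin

text \<open>
  The attractor is the closure of the union of the \<open>\<omega>\<close>-limit sets of all bounded sets, where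
  limits are taken along times \<open>h\<close> of the arrow \<open>\<Sigma>\<close> whose distance to \<open>frontier \<Sigma>\<close> tends to
  infinity.  Two facts carry the argument.

  The first is geometric.  A ball around a point of \<open>\<Sigma>\<close> that misses \<open>frontier \<Sigma>\<close> lies entirely
  in \<open>\<Sigma>\<close>, because it is connected.  Hence the deep part of \<open>\<Sigma>\<close> may be translated by any fixed
  vector, forwards \<^emph>\<open>and backwards\<close>, and stays deep (\<open>escapes_translate\<close>); backward translation
  is what makes the limit sets strictly, and not only forward, invariant.

  The second is asymptotic compactness (\<open>attracted_subseq_converges\<close>).  Trajectories that start
  in a bounded set and are observed at escaping times approach the compact set \<open>K\<close>, so they have
  convergent subsequences with limits in \<open>K\<close>.  With the first fact this gives strict invariance
  of every \<open>\<omega>\<close>-limit set: a limit \<open>y\<close> of \<open>S (h n) (b n)\<close> is the image under \<open>S g\<close> of a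
  subsequential limit of \<open>S (h n - g) (b n)\<close>.  It also gives attraction by contradiction, since a
  sequence that stays outside a neighbourhood of the attractor would have a limit point in an
  \<open>\<omega>\<close>-limit set.  Passing to the closure keeps invariance because continuous images of
  compact sets are closed.
\<close>

text \<open>Escape is demanded only eventually, so that it survives translation of the sequence.\<close>

definition escapes :: "'t::metric_space set \<Rightarrow> (nat \<Rightarrow> 't) \<Rightarrow> bool" where
  "escapes \<Sigma> h \<longleftrightarrow>
     (\<forall>D. \<forall>\<^sub>F n in sequentially. h n \<in> \<Sigma> \<and> ereal D \<le> set_distance (h n) (frontier \<Sigma>))"

definition omega_limit ::
    "'t::metric_space set \<Rightarrow> ('t \<Rightarrow> 'a::metric_space \<Rightarrow> 'a) \<Rightarrow> 'a set \<Rightarrow> 'a set" where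
  "omega_limit \<Sigma> S B =
     {y. \<exists>h b. escapes \<Sigma> h \<and> range b \<subseteq> B \<and> (\<lambda>n. S (h n) (b n)) \<longlonglongrightarrow> y}"

lemma le_set_distance_iff: "ereal D \<le> set_distance h V \<longleftrightarrow> (\<forall>v\<in>V. D \<le> dist h v)"
  by (simp add: set_distance_def le_INF_iff)

text \<open>
  The ball of radius \<open>D\<close> around \<open>h\<close> is connected and misses \<open>frontier \<Sigma>\<close>, so it cannot meet
  both \<open>\<Sigma>\<close> and its complement.
\<close>

lemma deep_translate:
  fixes h g :: "'t::real_normed_vector"
  assumes "h \<in> \<Sigma>" and deep: "ereal D \<le> set_distance h (frontier \<Sigma>)" and "norm g < D"
  shows "h + g \<in> \<Sigma>" and "ereal (D - norm g) \<le> set_distance (h + g) (frontier \<Sigma>)"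
proof -
  have far: "D \<le> dist h v" if "v \<in> frontier \<Sigma>" for v
    using deep that by (simp add: le_set_distance_iff)
  then have "ball h D \<inter> frontier \<Sigma> = {}"
    by fastforce
  moreover have "h \<in> ball h D \<inter> \<Sigma>"
    using assms le_less_trans[OF norm_ge_zero] by auto
  ultimately have "ball h D \<subseteq> \<Sigma>"
    using connected_Int_frontier[OF connected_ball, of h D \<Sigma>] by blast
  moreover have "h + g \<in> ball h D"
    using assms(3) by (simp add: dist_norm)
  ultimately show "h + g \<in> \<Sigma>" by blast
  have "dist h v \<le> norm g + dist (h + g) v" for v
    using dist_triangle[of h v "h + g"] by (simp add: dist_norm)
  then show "ereal (D - norm g) \<le> set_distance (h + g) (frontier \<Sigma>)"
    unfolding le_set_distance_iff using far by (smt (verit, best))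
qed

lemma escapes_translate:
  fixes h :: "nat \<Rightarrow> 't::real_normed_vector"
  assumes "escapes \<Sigma> h"
  shows "escapes \<Sigma> (\<lambda>n. h n + g)"
  unfolding escapes_def
proof
  fix D :: real
  \<comment> \<open>The summand \<open>norm g\<close> makes up for the depth lost by translating; the \<open>1\<close> ensures
    \<open>norm g < E\<close> also for \<open>D \<le> 0\<close>.\<close>
  define E where "E = max D 1 + norm g"
  have E: "norm g < E" "D \<le> E - norm g"
    by (auto simp: E_def)
  have "\<forall>\<^sub>F n in sequentially. h n \<in> \<Sigma> \<and> ereal E \<le> set_distance (h n) (frontier \<Sigma>)"
    using assms by (simp add: escapes_def)
  then show "\<forall>\<^sub>F n in sequentially.
      h n + g \<in> \<Sigma> \<and> ereal D \<le> set_distance (h n + g) (frontier \<Sigma>)"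
  proof eventually_elim
    case (elim n)
    with E(1) have "h n + g \<in> \<Sigma>"
      and "ereal (E - norm g) \<le> set_distance (h n + g) (frontier \<Sigma>)"
      by (blast intro: deep_translate)+
    moreover have "ereal D \<le> ereal (E - norm g)"
      using E(2) by simp
    ultimately show ?case
      by (blast intro: order_trans)
  qed
qed

lemma escapes_subseq:
  assumes "escapes \<Sigma> h" and "strict_mono r"
  shows "escapes \<Sigma> (h \<circ> r)"
  unfolding escapes_def comp_apply
proof
  fix D :: real
  show "\<forall>\<^sub>F n in sequentially.
      h (r n) \<in> \<Sigma> \<and> ereal D \<le> set_distance (h (r n)) (frontier \<Sigma>)"
    by (rule eventually_subseq[OF assms(2)]) (use assms(1) in \<open>simp add: escapes_def\<close>)
qed

lemma escapes_eventually_in: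
  assumes "escapes \<Sigma> h"
  shows "\<forall>\<^sub>F n in sequentially. h n \<in> \<Sigma>"
  using assms by (auto simp: escapes_def elim: eventually_mono)

lemma attracting_eventually:
  assumes "attracting \<B> \<Sigma> S K" and "B \<in> \<B>" and "escapes \<Sigma> h" and "range b \<subseteq> B"
    and "open U" and "K \<subseteq> U"
  shows "\<forall>\<^sub>F n in sequentially. S (h n) (b n) \<in> U"
proof -
  obtain D where D: "\<And>h. h \<in> \<Sigma> \<Longrightarrow> ereal D \<le> set_distance h (frontier \<Sigma>) \<Longrightarrow> S h ` B \<subseteq> U"
    using assms(1,2,5,6) unfolding attracting_def by (metis interior_open)
  have "\<forall>\<^sub>F n in sequentially. h n \<in> \<Sigma> \<and> ereal D \<le> set_distance (h n) (frontier \<Sigma>)"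
    using assms(3) by (simp add: escapes_def)
  then show ?thesis
    by eventually_elim (use D assms(4) in blast)
qed

text \<open>
  The points of \<open>K\<close> nearest to the sequence have a convergent subsequence by compactness, and
  the distance between the two sequences tends to zero by attraction.
\<close>

lemma attracted_subseq_converges:
  assumes "attracting \<B> \<Sigma> S K" and "compact K"
    and "B \<in> \<B>" and "escapes \<Sigma> h" and "range b \<subseteq> B"
  obtains l r where "l \<in> K" and "strict_mono r" and "(\<lambda>n. S (h (r n)) (b (r n))) \<longlonglongrightarrow> l"
proof -
  define x where "x n = S (h n) (b n)" for n
  note ev = attracting_eventually[OF assms(1,3,4,5), folded x_def]
  have "K \<noteq> {}"
    using ev[of "{}"] by auto
  then have "\<exists>k\<in>K. \<forall>y\<in>K. dist (x n) k \<le> dist (x n) y" for n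
    by (intro continuous_attains_inf assms(2) continuous_intros)
  then obtain k where k: "\<And>n. k n \<in> K" "\<And>n y. y \<in> K \<Longrightarrow> dist (x n) (k n) \<le> dist (x n) y"
    by metis
  have "(\<lambda>n. dist (x n) (k n)) \<longlonglongrightarrow> 0"
  proof (rule order_tendstoI)
    fix e :: real
    assume "0 < e"
    have "\<forall>\<^sub>F n in sequentially. x n \<in> (\<Union>y\<in>K. ball y e)"
      by (rule ev) (use \<open>0 < e\<close> in auto)
    then show "\<forall>\<^sub>F n in sequentially. dist (x n) (k n) < e"
    proof eventually_elim
      case (elim n)
      then obtain y where "y \<in> K" "dist (x n) y < e"
        by (auto simp: dist_commute)
      with k(2) show ?case
        by (blast intro: le_less_trans)
    qed
  next
    fix e :: real
    assume "e < 0"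
    then show "\<forall>\<^sub>F n in sequentially. e < dist (x n) (k n)"
      by (auto intro!: always_eventually intro: less_le_trans)
  qed
  moreover obtain l r where l: "l \<in> K" "strict_mono r" "(k \<circ> r) \<longlonglongrightarrow> l"
    using seq_compactE[OF compact_imp_seq_compact[OF assms(2)], of k] k(1) by blast
  ultimately have "(\<lambda>n. dist (x (r n)) (k (r n))) \<longlonglongrightarrow> 0"
    using LIMSEQ_subseq_LIMSEQ[of "\<lambda>n. dist (x n) (k n)" 0 r] by (simp add: o_def)
  moreover have "(\<lambda>n. dist (k (r n)) l) \<longlonglongrightarrow> 0"
    using l(3) tendsto_dist_iff[of "k \<circ> r" l] by (simp add: o_def)
  ultimately have "(\<lambda>n. dist (x (r n)) (k (r n)) + dist (k (r n)) l) \<longlonglongrightarrow> 0"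
    by (rule tendsto_add_zero)
  then have "(\<lambda>n. dist (x (r n)) l) \<longlonglongrightarrow> 0"
    by (rule tendsto_0_le[where K = 1])
      (auto intro!: always_eventually simp: dist_triangle)
  then have "(\<lambda>n. x (r n)) \<longlonglongrightarrow> l"
    by (rule tendsto_dist_iff[THEN iffD2])
  with l(1,2) show thesis
    unfolding x_def by (rule that)
qed

lemma omega_limit_subset:
  assumes "attracting \<B> \<Sigma> S K" and "compact K" and "B \<in> \<B>"
  shows "omega_limit \<Sigma> S B \<subseteq> K"
proof
  fix y
  assume "y \<in> omega_limit \<Sigma> S B"
  then obtain h b where hb: "escapes \<Sigma> h" "range b \<subseteq> B" "(\<lambda>n. S (h n) (b n)) \<longlonglongrightarrow> y"
    by (auto simp: omega_limit_def)
  obtain l r where "l \<in> K" and r: "strict_mono r"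
    and l: "(\<lambda>n. S (h (r n)) (b (r n))) \<longlonglongrightarrow> l"
    using attracted_subseq_converges[OF assms hb(1,2)] .
  have "(\<lambda>n. S (h (r n)) (b (r n))) \<longlonglongrightarrow> y"
    using LIMSEQ_subseq_LIMSEQ[OF hb(3) r] by (simp add: o_def)
  with l have "l = y"
    by (rule LIMSEQ_unique)
  with \<open>l \<in> K\<close> show "y \<in> K"
    by simp
qed

lemma omega_limit_invariant:
  fixes C \<Sigma> :: "(real ^ 'm) set"
  assumes "attracting \<B> \<Sigma> S K" and "compact K" and "B \<in> \<B>" and "\<Sigma> \<subseteq> C"
    and sg: "multi_semigroup C S" and "g \<in> C" and cont: "continuous_on UNIV (S g)"
  shows "S g ` omega_limit \<Sigma> S B = omega_limit \<Sigma> S B"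
proof (intro subset_antisym subsetI)
  fix z
  assume "z \<in> S g ` omega_limit \<Sigma> S B"
  then obtain h b y where hb: "escapes \<Sigma> h" "range b \<subseteq> B" "(\<lambda>n. S (h n) (b n)) \<longlonglongrightarrow> y"
    and z: "z = S g y"
    by (auto simp: omega_limit_def)
  have "(\<lambda>n. S g (S (h n) (b n))) \<longlonglongrightarrow> z"
    using continuous_on_tendsto_compose[OF cont hb(3)] z by simp
  moreover have "\<forall>\<^sub>F n in sequentially. S g (S (h n) (b n)) = S (h n + g) (b n)"
    using escapes_eventually_in[OF hb(1)]
  proof eventually_elim
    case (elim n)
    with sg assms(4,6) have "S (g + h n) = S g \<circ> S (h n)"
      unfolding multi_semigroup_def by blast
    then show ?case
      by (metis add.commute comp_apply)
  qed
  ultimately have "(\<lambda>n. S (h n + g) (b n)) \<longlonglongrightarrow> z"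
    by (rule Lim_transform_eventually)
  with hb(2) escapes_translate[OF hb(1), of g] show "z \<in> omega_limit \<Sigma> S B"
    unfolding omega_limit_def by fast
next
  fix y
  assume "y \<in> omega_limit \<Sigma> S B"
  then obtain h b where hb: "escapes \<Sigma> h" "range b \<subseteq> B" "(\<lambda>n. S (h n) (b n)) \<longlonglongrightarrow> y"
    by (auto simp: omega_limit_def)
  define h' where "h' n = h n - g" for n
  have esc: "escapes \<Sigma> h'"
    using escapes_translate[OF hb(1), of "- g"] by (simp add: h'_def[abs_def])
  obtain z r where r: "strict_mono r" and z: "(\<lambda>n. S (h' (r n)) (b (r n))) \<longlonglongrightarrow> z"
    using attracted_subseq_converges[OF assms(1-3) esc hb(2)] by blast
  have "z \<in> omega_limit \<Sigma> S B"
    unfolding omega_limit_def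
    using escapes_subseq[OF esc r] hb(2) z
    by (intro CollectI exI[of _ "h' \<circ> r"] exI[of _ "b \<circ> r"]) (auto simp: o_def)
  moreover have "S g z = y"
  proof (rule LIMSEQ_unique)
    have "(\<lambda>n. S g (S (h' (r n)) (b (r n)))) \<longlonglongrightarrow> S g z"
      using continuous_on_tendsto_compose[OF cont z] by simp
    moreover have "\<forall>\<^sub>F n in sequentially.
        S g (S (h' (r n)) (b (r n))) = S (h (r n)) (b (r n))"
      using escapes_eventually_in[OF escapes_subseq[OF esc r]]
    proof eventually_elim
      case (elim n)
      with sg assms(4,6) have "S (g + h' (r n)) = S g \<circ> S (h' (r n))"
        unfolding multi_semigroup_def comp_apply by blast
      moreover have "g + h' (r n) = h (r n)"
        by (simp add: h'_def)
      ultimately show ?case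
        by (metis comp_apply)
    qed
    ultimately show "(\<lambda>n. S (h (r n)) (b (r n))) \<longlonglongrightarrow> S g z"
      by (rule Lim_transform_eventually)
    show "(\<lambda>n. S (h (r n)) (b (r n))) \<longlonglongrightarrow> y"
      using LIMSEQ_subseq_LIMSEQ[OF hb(3) r] by (simp add: o_def)
  qed
  ultimately show "y \<in> S g ` omega_limit \<Sigma> S B"
    by blast
qed

text \<open>
  If some neighbourhood \<open>U\<close> of \<open>A\<close> failed, there would be times of depth at least \<open>n\<close>, for every
  \<open>n\<close>, that send a point of \<open>B\<close> outside \<open>U\<close>; a limit point of these images is in the
  \<open>\<omega>\<close>-limit set of \<open>B\<close>, but not in \<open>interior U\<close>.
\<close>

lemma attracting_if_contains_omega_limits:
  assumes "attracting \<B> \<Sigma> S K" and "compact K"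
    and "\<And>B. B \<in> \<B> \<Longrightarrow> omega_limit \<Sigma> S B \<subseteq> A"
  shows "attracting \<B> \<Sigma> S A"
  unfolding attracting_def
proof (intro ballI allI impI, rule ccontr)
  fix B U
  assume "B \<in> \<B>" and U: "A \<subseteq> interior U"
    and "\<not> (\<exists>D>0. \<forall>h\<in>\<Sigma>. ereal D \<le> set_distance h (frontier \<Sigma>) \<longrightarrow> S h ` B \<subseteq> U)"
  then have "\<exists>h b. h \<in> \<Sigma> \<and> ereal (real (Suc n)) \<le> set_distance h (frontier \<Sigma>) \<and>
      b \<in> B \<and> S h b \<notin> U" for n
    by (metis image_subset_iff of_nat_0_less_iff zero_less_Suc)
  then obtain h b where hb: "\<And>n. h n \<in> \<Sigma>" "\<And>n. b n \<in> B" "\<And>n. S (h n) (b n) \<notin> U"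
    and deep: "\<And>n. ereal (real (Suc n)) \<le> set_distance (h n) (frontier \<Sigma>)"
    by metis
  have esc: "escapes \<Sigma> h"
    unfolding escapes_def
  proof
    fix D :: real
    have "\<forall>\<^sub>F n in sequentially. D \<le> real (Suc n)"
      by (rule eventually_sequentiallyI[of "nat \<lceil>D\<rceil>"]) linarith
    then show "\<forall>\<^sub>F n in sequentially. h n \<in> \<Sigma> \<and> ereal D \<le> set_distance (h n) (frontier \<Sigma>)"
    proof eventually_elim
      case (elim n)
      then have "ereal D \<le> ereal (real (Suc n))"
        by simp
      with hb(1) deep[of n] show ?case
        by (blast intro: order_trans)
    qed
  qed
  obtain l r where r: "strict_mono r" and l: "(\<lambda>n. S (h (r n)) (b (r n))) \<longlonglongrightarrow> l"
    using attracted_subseq_converges[OF assms(1,2) \<open>B \<in> \<B>\<close> esc] hb(2) by blast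
  have "l \<in> omega_limit \<Sigma> S B"
    unfolding omega_limit_def using escapes_subseq[OF esc r] hb(2) l
    by (intro CollectI exI[of _ "h \<circ> r"] exI[of _ "b \<circ> r"]) (auto simp: o_def)
  then have "l \<in> interior U"
    using assms(3) \<open>B \<in> \<B>\<close> U by blast
  then have "\<forall>\<^sub>F n in sequentially. S (h (r n)) (b (r n)) \<in> interior U"
    using topological_tendstoD[OF l open_interior] by blast
  then have "\<forall>\<^sub>F n::nat in sequentially. False"
    by eventually_elim (use hb(3) interior_subset in blast)
  then show False
    by simp
qed

lemma image_closure_invariant:
  fixes f :: "'a::metric_space \<Rightarrow> 'a"
  assumes "continuous_on UNIV f" and "f ` W = W" and "compact (closure W)"
  shows "f ` closure W = closure W"
proof
  have cont: "continuous_on (closure W) f"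
    using assms(1) continuous_on_subset by blast
  then show "f ` closure W \<subseteq> closure W"
    using image_closure_subset[of W f "closure W"] assms(2) closure_subset by auto
  have "closed (f ` closure W)"
    using cont assms(3) by (intro compact_imp_closed compact_continuous_image)
  moreover have "W \<subseteq> f ` closure W"
    using assms(2) closure_subset by (metis image_mono)
  ultimately show "closure W \<subseteq> f ` closure W"
    by (simp add: closure_minimal)
qed

theorem theorem2p5:
  fixes \<B> :: "'a::metric_space set set"
    and C \<Sigma> :: "(real ^ 'm) set"
    and S :: "real ^ 'm \<Rightarrow> 'a \<Rightarrow> 'a"
    and K :: "'a set"
  assumes "time_cone C"
    and "time_arrow C \<Sigma>"
    and "multi_semigroup C S"
    and "\<And>h. h \<in> C \<Longrightarrow> continuous_on UNIV (S h)"
    and "compact K"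
    and "attracting \<B> \<Sigma> S K"
  shows "\<exists>A. A \<subseteq> K \<and> attractor \<B> C \<Sigma> S A"
proof -
  define W where "W = (\<Union>B\<in>\<B>. omega_limit \<Sigma> S B)"
  have "\<Sigma> \<subseteq> C"
    using assms(2) by (simp add: time_arrow_def)
  have "W \<subseteq> K"
    using omega_limit_subset[OF assms(6,5)] by (auto simp: W_def)
  then have sub: "closure W \<subseteq> K"
    by (simp add: assms(5) closure_minimal compact_imp_closed)
  then have comp: "compact (closure W)"
    using assms(5) by (metis closed_closure compact_Int_closed inf.absorb_iff2)
  have "S g ` closure W = closure W" if "g \<in> C" for g
  proof (rule image_closure_invariant)
    show "S g ` W = W"
      using omega_limit_invariant[OF assms(6,5) _ \<open>\<Sigma> \<subseteq> C\<close> assms(3) that assms(4)[OF that]]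
      by (simp add: W_def image_UN)
  qed (use comp assms(4) that in auto)
  moreover have "attracting \<B> \<Sigma> S (closure W)"
    using assms(6,5)
  proof (rule attracting_if_contains_omega_limits)
    fix B
    assume "B \<in> \<B>"
    then show "omega_limit \<Sigma> S B \<subseteq> closure W"
      using closure_subset by (fastforce simp: W_def)
  qed
  ultimately have "attractor \<B> C \<Sigma> S (closure W)"
    using comp by (simp add: attractor_def)
  with sub show ?thesis
    by blast
qed

end
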